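(* Let $\mathcal{U}$ be a universe. All pointed types in $\mathcal{U}$ are algebraically $\mathcal{U},\mathcal{U}$-injective if and only if excluded middle holds in $\mathcal{U}$. (This is a logical equivalence: constructions in both directions between $\Pi(D:\mathcal{U}),\,D\to(D\text{ is algebraically }\mathcal{U},\mathcal{U}\text{-injective})$ and $\mathrm{EM}_{\mathcal{U}}$.)
   Context: Foundation: intensional Martin-Löf type theory with $\mathbb{0},\mathbb{1},\mathbb{N},+,\Pi,\Sigma,\mathrm{Id}$ and universes $\mathcal{U},\mathcal{V},\mathcal{W},\mathcal{T}$ (not assumed cumulative), with successor $\mathcal{U}^+$ and least upper bound $\mathcal{U}\sqcup\mathcal{V}$. Univalence (hence function and propositional extensionality) and existence of propositional truncations are assumed. No resizing principle is assumed. A subsingleton (proposition) is a type any two of whose elements are equal. A pointed type is a type with a designated element. A map $j:X\to Y$ is an embedding if each fiber $j^{-1}(y):=\Sigma(x:X),\,j\,x=y$ is a subsingleton; $X\hookrightarrow Y$ is the type of embeddings. $f\sim g$ means pointwise equality. A type $D$ (in any universe) is algebraically $\mathcal{U},\mathcal{V}$-injective if it is equipped with an element of $$\Pi(X:\mathcal{U})\,\Pi(Y:\mathcal{V})\,\Pi(j:X\hookrightarrow Y)\,\Pi(f:X\to D),\ \Sigma(g:Y\to D),\ g\circ j\sim f.$$ Excluded middle in $\mathcal{U}$: $\mathrm{EM}_{\mathcal{U}}:=\Pi(P:\mathcal{U}),\ P\text{ is a subsingleton}\to P+(P\to\mathbb{0})$. *)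

theory Defs
  imports Main
begin

text \<open>
  Intensional Martin-Loef type theory with univalence and propositional truncations, as an
  object theory: de Bruijn terms, typing and typed judgemental equality.
\<close>

section \<open>Universe levels\<close>

text \<open>
  An arbitrary join-semilattice with a strictly increasing, join-preserving successor covers both
  a concrete tower of universes and level expressions built from level variables.
\<close>

class universe_level = semilattice_sup +
  fixes lsuc :: "'a \<Rightarrow> 'a"
  assumes less_lsuc: "a < lsuc a"
    and lsuc_sup: "lsuc (sup a b) = sup (lsuc a) (lsuc b)"

instantiation nat :: universe_level
begin
definition lsuc_nat :: "nat \<Rightarrow> nat" where "lsuc_nat = Suc"
instance by standard (auto simp: lsuc_nat_def sup_nat_def)
end


section \<open>Raw terms\<close>

text \<open>
  \<open>Ax\<close> denotes the postulated constants: univalence of a universe, and the truncation of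
  types of a universe, whose recursion principle may target propositions of any universe.
  They have no computation rules.
\<close>

datatype 'l ax =
    Univalence 'l
  | Trunc 'l
  | TruncIn 'l
  | TruncProp 'l
  | TruncRec 'l 'l

text \<open>
  Universes are Russell style.  The types \<open>\<zero>\<close>, \<open>\<one>\<close>, \<open>\<nat>\<close> carry the level of the universe they
  belong to: universes are not cumulative, and each one is closed under these types.

  Binding: \<open>Pi A B\<close>, \<open>Lam A b\<close> and \<open>Sig A B\<close> bind one variable in the second argument.  The first
  argument of an eliminator is its motive, binding the scrutinee; for \<open>J\<close> it binds the two end
  points and the path, so that the path is variable 0.  The branch of \<open>Split\<close> and the successor
  branch of \<open>NatRec\<close> bind two variables; those of \<open>Cases\<close>, and that of \<open>J\<close>, bind one.
\<close>

datatype 'l tm =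
    Var nat
  | Univ 'l
  | Pi "'l tm" "'l tm"
  | Lam "'l tm" "'l tm"
  | App "'l tm" "'l tm"
  | Sig "'l tm" "'l tm"
  | Pr "'l tm" "'l tm"
  | Split "'l tm" "'l tm" "'l tm"
  | Plus "'l tm" "'l tm"
  | InL "'l tm"
  | InR "'l tm"
  | Cases "'l tm" "'l tm" "'l tm" "'l tm"
  | Empty 'l
  | Absurd "'l tm" "'l tm"
  | Unit 'l
  | Star 'l
  | UnitRec "'l tm" "'l tm" "'l tm"
  | NatT 'l
  | Zero 'l
  | Succ "'l tm"
  | NatRec "'l tm" "'l tm" "'l tm" "'l tm"
  | IdT "'l tm" "'l tm" "'l tm"
  | Rfl "'l tm"
  | J "'l tm" "'l tm" "'l tm" "'l tm" "'l tm"
  | Ax "'l ax"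

definition scons :: "'a \<Rightarrow> (nat \<Rightarrow> 'a) \<Rightarrow> nat \<Rightarrow> 'a"  (infixr "##" 65)
  where "scons t \<sigma> = (\<lambda>n. case n of 0 \<Rightarrow> t | Suc m \<Rightarrow> \<sigma> m)"

definition upr :: "(nat \<Rightarrow> nat) \<Rightarrow> nat \<Rightarrow> nat"
  where "upr \<xi> = 0 ## (\<lambda>n. Suc (\<xi> n))"

primrec rename :: "(nat \<Rightarrow> nat) \<Rightarrow> 'l tm \<Rightarrow> 'l tm" where
  "rename \<xi> (Var n) = Var (\<xi> n)"
| "rename \<xi> (Univ l) = Univ l"
| "rename \<xi> (Pi A B) = Pi (rename \<xi> A) (rename (upr \<xi>) B)"
| "rename \<xi> (Lam A b) = Lam (rename \<xi> A) (rename (upr \<xi>) b)"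
| "rename \<xi> (App f a) = App (rename \<xi> f) (rename \<xi> a)"
| "rename \<xi> (Sig A B) = Sig (rename \<xi> A) (rename (upr \<xi>) B)"
| "rename \<xi> (Pr a b) = Pr (rename \<xi> a) (rename \<xi> b)"
| "rename \<xi> (Split C d p) =
    Split (rename (upr \<xi>) C) (rename (upr (upr \<xi>)) d) (rename \<xi> p)"
| "rename \<xi> (Plus A B) = Plus (rename \<xi> A) (rename \<xi> B)"
| "rename \<xi> (InL a) = InL (rename \<xi> a)"
| "rename \<xi> (InR b) = InR (rename \<xi> b)"
| "rename \<xi> (Cases C c d s) =
    Cases (rename (upr \<xi>) C) (rename (upr \<xi>) c) (rename (upr \<xi>) d) (rename \<xi> s)"
| "rename \<xi> (Empty l) = Empty l"
| "rename \<xi> (Absurd C e) = Absurd (rename (upr \<xi>) C) (rename \<xi> e)"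
| "rename \<xi> (Unit l) = Unit l"
| "rename \<xi> (Star l) = Star l"
| "rename \<xi> (UnitRec C c u) = UnitRec (rename (upr \<xi>) C) (rename \<xi> c) (rename \<xi> u)"
| "rename \<xi> (NatT l) = NatT l"
| "rename \<xi> (Zero l) = Zero l"
| "rename \<xi> (Succ n) = Succ (rename \<xi> n)"
| "rename \<xi> (NatRec C c d n) =
    NatRec (rename (upr \<xi>) C) (rename \<xi> c) (rename (upr (upr \<xi>)) d) (rename \<xi> n)"
| "rename \<xi> (IdT A a b) = IdT (rename \<xi> A) (rename \<xi> a) (rename \<xi> b)"
| "rename \<xi> (Rfl a) = Rfl (rename \<xi> a)"
| "rename \<xi> (J C c a b p) =
    J (rename (upr (upr (upr \<xi>))) C) (rename (upr \<xi>) c) (rename \<xi> a) (rename \<xi> b) (rename \<xi> p)"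
| "rename \<xi> (Ax c) = Ax c"

definition up :: "(nat \<Rightarrow> 'l tm) \<Rightarrow> nat \<Rightarrow> 'l tm"
  where "up \<sigma> = Var 0 ## (\<lambda>n. rename Suc (\<sigma> n))"

primrec subst :: "(nat \<Rightarrow> 'l tm) \<Rightarrow> 'l tm \<Rightarrow> 'l tm" where
  "subst \<sigma> (Var n) = \<sigma> n"
| "subst \<sigma> (Univ l) = Univ l"
| "subst \<sigma> (Pi A B) = Pi (subst \<sigma> A) (subst (up \<sigma>) B)"
| "subst \<sigma> (Lam A b) = Lam (subst \<sigma> A) (subst (up \<sigma>) b)"
| "subst \<sigma> (App f a) = App (subst \<sigma> f) (subst \<sigma> a)"
| "subst \<sigma> (Sig A B) = Sig (subst \<sigma> A) (subst (up \<sigma>) B)"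
| "subst \<sigma> (Pr a b) = Pr (subst \<sigma> a) (subst \<sigma> b)"
| "subst \<sigma> (Split C d p) = Split (subst (up \<sigma>) C) (subst (up (up \<sigma>)) d) (subst \<sigma> p)"
| "subst \<sigma> (Plus A B) = Plus (subst \<sigma> A) (subst \<sigma> B)"
| "subst \<sigma> (InL a) = InL (subst \<sigma> a)"
| "subst \<sigma> (InR b) = InR (subst \<sigma> b)"
| "subst \<sigma> (Cases C c d s) =
    Cases (subst (up \<sigma>) C) (subst (up \<sigma>) c) (subst (up \<sigma>) d) (subst \<sigma> s)"
| "subst \<sigma> (Empty l) = Empty l"
| "subst \<sigma> (Absurd C e) = Absurd (subst (up \<sigma>) C) (subst \<sigma> e)"
| "subst \<sigma> (Unit l) = Unit l"
| "subst \<sigma> (Star l) = Star l"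
| "subst \<sigma> (UnitRec C c u) = UnitRec (subst (up \<sigma>) C) (subst \<sigma> c) (subst \<sigma> u)"
| "subst \<sigma> (NatT l) = NatT l"
| "subst \<sigma> (Zero l) = Zero l"
| "subst \<sigma> (Succ n) = Succ (subst \<sigma> n)"
| "subst \<sigma> (NatRec C c d n) =
    NatRec (subst (up \<sigma>) C) (subst \<sigma> c) (subst (up (up \<sigma>)) d) (subst \<sigma> n)"
| "subst \<sigma> (IdT A a b) = IdT (subst \<sigma> A) (subst \<sigma> a) (subst \<sigma> b)"
| "subst \<sigma> (Rfl a) = Rfl (subst \<sigma> a)"
| "subst \<sigma> (J C c a b p) =
    J (subst (up (up (up \<sigma>))) C) (subst (up \<sigma>) c) (subst \<sigma> a) (subst \<sigma> b) (subst \<sigma> p)"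
| "subst \<sigma> (Ax c) = Ax c"

definition wk :: "nat \<Rightarrow> 'l tm \<Rightarrow> 'l tm"
  where "wk k = rename (\<lambda>n. n + k)"

definition sh :: "nat \<Rightarrow> nat \<Rightarrow> 'l tm"
  where "sh k = (\<lambda>n. Var (n + k))"

definition inst :: "'l tm \<Rightarrow> 'l tm \<Rightarrow> 'l tm"
  where "inst a = subst (a ## Var)"


section \<open>Derived notions of the object theory\<close>

definition Arr :: "'l tm \<Rightarrow> 'l tm \<Rightarrow> 'l tm"
  where "Arr A B = Pi A (wk 1 B)"

definition Prod :: "'l tm \<Rightarrow> 'l tm \<Rightarrow> 'l tm"
  where "Prod A B = Sig A (wk 1 B)"

definition idf :: "'l tm \<Rightarrow> 'l tm"
  where "idf A = Lam A (Var 0)"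

text \<open>The first projection out of a \<open>\<Sigma>\<close>-type with first component \<open>A\<close>.\<close>

definition Fst :: "'l tm \<Rightarrow> 'l tm \<Rightarrow> 'l tm"
  where "Fst A p = Split (wk 1 A) (Var 1) p"

definition is_subsingleton :: "'l tm \<Rightarrow> 'l tm"
  where "is_subsingleton A = Pi A (Pi (wk 1 A) (IdT (wk 2 A) (Var 1) (Var 0)))"

text \<open>\<open>\<Sigma>(x : X), j x = y\<close>\<close>

definition fiber :: "'l tm \<Rightarrow> 'l tm \<Rightarrow> 'l tm \<Rightarrow> 'l tm \<Rightarrow> 'l tm"
  where "fiber X Y j y = Sig X (IdT (wk 1 Y) (App (wk 1 j) (Var 0)) (wk 1 y))"

definition is_embedding :: "'l tm \<Rightarrow> 'l tm \<Rightarrow> 'l tm \<Rightarrow> 'l tm"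
  where "is_embedding X Y j = Pi Y (is_subsingleton (fiber (wk 1 X) (wk 1 Y) (wk 1 j) (Var 0)))"

definition Emb :: "'l tm \<Rightarrow> 'l tm \<Rightarrow> 'l tm"
  where "Emb X Y = Sig (Arr X Y) (is_embedding (wk 1 X) (wk 1 Y) (Var 0))"

text \<open>\<open>\<Pi> (x : X), f x = g x\<close>\<close>

definition pointwise_eq :: "'l tm \<Rightarrow> 'l tm \<Rightarrow> 'l tm \<Rightarrow> 'l tm \<Rightarrow> 'l tm"
  where "pointwise_eq X Y f g =
    Pi X (IdT (wk 1 Y) (App (wk 1 f) (Var 0)) (App (wk 1 g) (Var 0)))"

definition comp :: "'l tm \<Rightarrow> 'l tm \<Rightarrow> 'l tm \<Rightarrow> 'l tm"
  where "comp X g f = Lam X (App (wk 1 g) (App (wk 1 f) (Var 0)))"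

text \<open>
  \<open>\<Pi>(X : \<U>) \<Pi>(Y : \<V>) \<Pi>(j : X \<hookrightarrow> Y) \<Pi>(f : X \<rightarrow> D), \<Sigma>(g : Y \<rightarrow> D), g \<circ> j \<sim> f\<close>;
  in the innermost scope \<open>g\<close>, \<open>f\<close>, \<open>j\<close>, \<open>Y\<close>, \<open>X\<close> are the variables 0 to 4.
\<close>

definition alg_injective :: "'l \<Rightarrow> 'l \<Rightarrow> 'l tm \<Rightarrow> 'l tm"
  where "alg_injective u v D =
    Pi (Univ u) (Pi (Univ v) (Pi (Emb (Var 1) (Var 0)) (Pi (Arr (Var 2) (wk 3 D))
      (Sig (Arr (Var 2) (wk 4 D))
        (pointwise_eq (Var 4) (wk 5 D)
          (comp (Var 4) (Var 0) (Fst (Arr (Var 4) (Var 3)) (Var 2)))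
          (Var 1))))))"

definition all_pointed_alg_injective :: "'l \<Rightarrow> 'l tm"
  where "all_pointed_alg_injective u = Pi (Univ u) (Arr (Var 0) (alg_injective u u (Var 0)))"

definition excluded_middle :: "'l \<Rightarrow> 'l tm"
  where "excluded_middle u =
    Pi (Univ u) (Arr (is_subsingleton (Var 0)) (Plus (Var 0) (Arr (Var 0) (Empty u))))"


section \<open>Types of the postulated constants\<close>

text \<open>A map is an equivalence if it has a section and a retraction.\<close>

definition is_equiv :: "'l tm \<Rightarrow> 'l tm \<Rightarrow> 'l tm \<Rightarrow> 'l tm"
  where "is_equiv X Y f = Prod
    (Sig (Arr Y X)
      (pointwise_eq (wk 1 Y) (wk 1 Y) (comp (wk 1 Y) (wk 1 f) (Var 0)) (idf (wk 1 Y))))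
    (Sig (Arr Y X)
      (pointwise_eq (wk 1 X) (wk 1 X) (comp (wk 1 X) (Var 0) (wk 1 f)) (idf (wk 1 X))))"

definition Equiv :: "'l tm \<Rightarrow> 'l tm \<Rightarrow> 'l tm"
  where "Equiv X Y = Sig (Arr X Y) (is_equiv (wk 1 X) (wk 1 Y) (Var 0))"

definition id_equiv :: "'l tm \<Rightarrow> 'l tm"
  where "id_equiv X = Pr (idf X)
    (Pr (Pr (idf X) (Lam X (Rfl (Var 0)))) (Pr (idf X) (Lam X (Rfl (Var 0)))))"

definition id_to_equiv :: "'l \<Rightarrow> 'l tm \<Rightarrow> 'l tm \<Rightarrow> 'l tm"
  where "id_to_equiv u X Y = Lam (IdT (Univ u) X Y)
    (J (Equiv (Var 2) (Var 1)) (id_equiv (Var 0)) (wk 1 X) (wk 1 Y) (Var 0))"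

primrec ax_type :: "'l ax \<Rightarrow> 'l tm" where
  "ax_type (Univalence u) = Pi (Univ u) (Pi (Univ u)
    (is_equiv (IdT (Univ u) (Var 1) (Var 0)) (Equiv (Var 1) (Var 0))
      (id_to_equiv u (Var 1) (Var 0))))"
| "ax_type (Trunc u) = Arr (Univ u) (Univ u)"
| "ax_type (TruncIn u) = Pi (Univ u) (Arr (Var 0) (App (Ax (Trunc u)) (Var 0)))"
| "ax_type (TruncProp u) = Pi (Univ u) (is_subsingleton (App (Ax (Trunc u)) (Var 0)))"
| "ax_type (TruncRec u v) = Pi (Univ u) (Pi (Univ v)
    (Arr (is_subsingleton (Var 0))
      (Arr (Arr (Var 1) (Var 0)) (Arr (App (Ax (Trunc u)) (Var 1)) (Var 0)))))"


section \<open>Judgements\<close>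

text \<open>
  The head of a context is the type of the most recent variable.  Being a type means being an
  element of some universe.
\<close>

inductive
  wf_ctx :: "'l::universe_level tm list \<Rightarrow> bool"  ("_ \<turnstile> ctx" [51] 50) and
  has_type :: "'l tm list \<Rightarrow> 'l tm \<Rightarrow> 'l tm \<Rightarrow> bool"  ("_ \<turnstile> _ \<Colon> _" [51, 51, 51] 50) and
  jeq :: "'l tm list \<Rightarrow> 'l tm \<Rightarrow> 'l tm \<Rightarrow> 'l tm \<Rightarrow> bool"
    ("_ \<turnstile> _ \<doteq> _ \<Colon> _" [51, 51, 51, 51] 50)
where
  ctx_nil: "[] \<turnstile> ctx"
| ctx_cons: "\<lbrakk>\<Gamma> \<turnstile> ctx; \<Gamma> \<turnstile> A \<Colon> Univ i\<rbrakk> \<Longrightarrow> A # \<Gamma> \<turnstile> ctx"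

| ty_var: "\<lbrakk>\<Gamma> \<turnstile> ctx; n < length \<Gamma>\<rbrakk> \<Longrightarrow> \<Gamma> \<turnstile> Var n \<Colon> wk (Suc n) (\<Gamma> ! n)"
| ty_conv: "\<lbrakk>\<Gamma> \<turnstile> a \<Colon> A; \<Gamma> \<turnstile> A \<doteq> B \<Colon> Univ i\<rbrakk> \<Longrightarrow> \<Gamma> \<turnstile> a \<Colon> B"
| ty_univ: "\<Gamma> \<turnstile> ctx \<Longrightarrow> \<Gamma> \<turnstile> Univ i \<Colon> Univ (lsuc i)"
| ty_ax: "\<Gamma> \<turnstile> ctx \<Longrightarrow> \<Gamma> \<turnstile> Ax c \<Colon> ax_type c"

| ty_pi: "\<lbrakk>\<Gamma> \<turnstile> A \<Colon> Univ i; A # \<Gamma> \<turnstile> B \<Colon> Univ j\<rbrakk> \<Longrightarrow> \<Gamma> \<turnstile> Pi A B \<Colon> Univ (sup i j)"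
| ty_lam: "\<lbrakk>\<Gamma> \<turnstile> A \<Colon> Univ i; A # \<Gamma> \<turnstile> b \<Colon> B\<rbrakk> \<Longrightarrow> \<Gamma> \<turnstile> Lam A b \<Colon> Pi A B"
| ty_app: "\<lbrakk>\<Gamma> \<turnstile> f \<Colon> Pi A B; \<Gamma> \<turnstile> a \<Colon> A\<rbrakk> \<Longrightarrow> \<Gamma> \<turnstile> App f a \<Colon> inst a B"

| ty_sig: "\<lbrakk>\<Gamma> \<turnstile> A \<Colon> Univ i; A # \<Gamma> \<turnstile> B \<Colon> Univ j\<rbrakk> \<Longrightarrow> \<Gamma> \<turnstile> Sig A B \<Colon> Univ (sup i j)"
| ty_pr: "\<lbrakk>A # \<Gamma> \<turnstile> B \<Colon> Univ j; \<Gamma> \<turnstile> a \<Colon> A; \<Gamma> \<turnstile> b \<Colon> inst a B\<rbrakk> \<Longrightarrow> \<Gamma> \<turnstile> Pr a b \<Colon> Sig A B"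
| ty_split: "\<lbrakk>Sig A B # \<Gamma> \<turnstile> C \<Colon> Univ k;
    B # A # \<Gamma> \<turnstile> d \<Colon> subst (Pr (Var 1) (Var 0) ## sh 2) C;
    \<Gamma> \<turnstile> p \<Colon> Sig A B\<rbrakk> \<Longrightarrow> \<Gamma> \<turnstile> Split C d p \<Colon> inst p C"

| ty_plus: "\<lbrakk>\<Gamma> \<turnstile> A \<Colon> Univ i; \<Gamma> \<turnstile> B \<Colon> Univ j\<rbrakk> \<Longrightarrow> \<Gamma> \<turnstile> Plus A B \<Colon> Univ (sup i j)"
| ty_inl: "\<lbrakk>\<Gamma> \<turnstile> a \<Colon> A; \<Gamma> \<turnstile> B \<Colon> Univ j\<rbrakk> \<Longrightarrow> \<Gamma> \<turnstile> InL a \<Colon> Plus A B"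
| ty_inr: "\<lbrakk>\<Gamma> \<turnstile> A \<Colon> Univ i; \<Gamma> \<turnstile> b \<Colon> B\<rbrakk> \<Longrightarrow> \<Gamma> \<turnstile> InR b \<Colon> Plus A B"
| ty_cases: "\<lbrakk>Plus A B # \<Gamma> \<turnstile> C \<Colon> Univ k;
    A # \<Gamma> \<turnstile> c \<Colon> subst (InL (Var 0) ## sh 1) C;
    B # \<Gamma> \<turnstile> d \<Colon> subst (InR (Var 0) ## sh 1) C;
    \<Gamma> \<turnstile> s \<Colon> Plus A B\<rbrakk> \<Longrightarrow> \<Gamma> \<turnstile> Cases C c d s \<Colon> inst s C"

| ty_empty: "\<Gamma> \<turnstile> ctx \<Longrightarrow> \<Gamma> \<turnstile> Empty i \<Colon> Univ i"
| ty_absurd: "\<lbrakk>Empty i # \<Gamma> \<turnstile> C \<Colon> Univ k; \<Gamma> \<turnstile> e \<Colon> Empty i\<rbrakk> \<Longrightarrow> \<Gamma> \<turnstile> Absurd C e \<Colon> inst e C"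

| ty_unit: "\<Gamma> \<turnstile> ctx \<Longrightarrow> \<Gamma> \<turnstile> Unit i \<Colon> Univ i"
| ty_star: "\<Gamma> \<turnstile> ctx \<Longrightarrow> \<Gamma> \<turnstile> Star i \<Colon> Unit i"
| ty_unitrec: "\<lbrakk>Unit i # \<Gamma> \<turnstile> C \<Colon> Univ k; \<Gamma> \<turnstile> c \<Colon> inst (Star i) C; \<Gamma> \<turnstile> u \<Colon> Unit i\<rbrakk>
    \<Longrightarrow> \<Gamma> \<turnstile> UnitRec C c u \<Colon> inst u C"

| ty_nat: "\<Gamma> \<turnstile> ctx \<Longrightarrow> \<Gamma> \<turnstile> NatT i \<Colon> Univ i"
| ty_zero: "\<Gamma> \<turnstile> ctx \<Longrightarrow> \<Gamma> \<turnstile> Zero i \<Colon> NatT i"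
| ty_succ: "\<Gamma> \<turnstile> n \<Colon> NatT i \<Longrightarrow> \<Gamma> \<turnstile> Succ n \<Colon> NatT i"
| ty_natrec: "\<lbrakk>NatT i # \<Gamma> \<turnstile> C \<Colon> Univ k; \<Gamma> \<turnstile> c \<Colon> inst (Zero i) C;
    C # NatT i # \<Gamma> \<turnstile> d \<Colon> subst (Succ (Var 1) ## sh 2) C; \<Gamma> \<turnstile> n \<Colon> NatT i\<rbrakk>
    \<Longrightarrow> \<Gamma> \<turnstile> NatRec C c d n \<Colon> inst n C"

| ty_id: "\<lbrakk>\<Gamma> \<turnstile> A \<Colon> Univ i; \<Gamma> \<turnstile> a \<Colon> A; \<Gamma> \<turnstile> b \<Colon> A\<rbrakk> \<Longrightarrow> \<Gamma> \<turnstile> IdT A a b \<Colon> Univ i"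
| ty_rfl: "\<Gamma> \<turnstile> a \<Colon> A \<Longrightarrow> \<Gamma> \<turnstile> Rfl a \<Colon> IdT A a a"
| ty_j: "\<lbrakk>IdT (wk 2 A) (Var 1) (Var 0) # wk 1 A # A # \<Gamma> \<turnstile> C \<Colon> Univ k;
    A # \<Gamma> \<turnstile> c \<Colon> subst (Rfl (Var 0) ## Var 0 ## Var 0 ## sh 1) C;
    \<Gamma> \<turnstile> a \<Colon> A; \<Gamma> \<turnstile> b \<Colon> A; \<Gamma> \<turnstile> p \<Colon> IdT A a b\<rbrakk>
    \<Longrightarrow> \<Gamma> \<turnstile> J C c a b p \<Colon> subst (p ## b ## a ## Var) C"

| eq_refl: "\<Gamma> \<turnstile> a \<Colon> A \<Longrightarrow> \<Gamma> \<turnstile> a \<doteq> a \<Colon> A"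
| eq_sym: "\<Gamma> \<turnstile> a \<doteq> b \<Colon> A \<Longrightarrow> \<Gamma> \<turnstile> b \<doteq> a \<Colon> A"
| eq_trans: "\<lbrakk>\<Gamma> \<turnstile> a \<doteq> b \<Colon> A; \<Gamma> \<turnstile> b \<doteq> c \<Colon> A\<rbrakk> \<Longrightarrow> \<Gamma> \<turnstile> a \<doteq> c \<Colon> A"
| eq_conv: "\<lbrakk>\<Gamma> \<turnstile> a \<doteq> b \<Colon> A; \<Gamma> \<turnstile> A \<doteq> B \<Colon> Univ i\<rbrakk> \<Longrightarrow> \<Gamma> \<turnstile> a \<doteq> b \<Colon> B"

| beta_pi: "\<lbrakk>\<Gamma> \<turnstile> A \<Colon> Univ i; A # \<Gamma> \<turnstile> b \<Colon> B; \<Gamma> \<turnstile> a \<Colon> A\<rbrakk>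
    \<Longrightarrow> \<Gamma> \<turnstile> App (Lam A b) a \<doteq> inst a b \<Colon> inst a B"
| eta_pi: "\<Gamma> \<turnstile> f \<Colon> Pi A B \<Longrightarrow> \<Gamma> \<turnstile> f \<doteq> Lam A (App (wk 1 f) (Var 0)) \<Colon> Pi A B"
| beta_sig: "\<lbrakk>Sig A B # \<Gamma> \<turnstile> C \<Colon> Univ k;
    B # A # \<Gamma> \<turnstile> d \<Colon> subst (Pr (Var 1) (Var 0) ## sh 2) C;
    \<Gamma> \<turnstile> a \<Colon> A; \<Gamma> \<turnstile> b \<Colon> inst a B\<rbrakk>
    \<Longrightarrow> \<Gamma> \<turnstile> Split C d (Pr a b) \<doteq> subst (b ## a ## Var) d \<Colon> inst (Pr a b) C"
| beta_inl: "\<lbrakk>Plus A B # \<Gamma> \<turnstile> C \<Colon> Univ k;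
    A # \<Gamma> \<turnstile> c \<Colon> subst (InL (Var 0) ## sh 1) C;
    B # \<Gamma> \<turnstile> d \<Colon> subst (InR (Var 0) ## sh 1) C;
    \<Gamma> \<turnstile> a \<Colon> A\<rbrakk> \<Longrightarrow> \<Gamma> \<turnstile> Cases C c d (InL a) \<doteq> inst a c \<Colon> inst (InL a) C"
| beta_inr: "\<lbrakk>Plus A B # \<Gamma> \<turnstile> C \<Colon> Univ k;
    A # \<Gamma> \<turnstile> c \<Colon> subst (InL (Var 0) ## sh 1) C;
    B # \<Gamma> \<turnstile> d \<Colon> subst (InR (Var 0) ## sh 1) C;
    \<Gamma> \<turnstile> b \<Colon> B\<rbrakk> \<Longrightarrow> \<Gamma> \<turnstile> Cases C c d (InR b) \<doteq> inst b d \<Colon> inst (InR b) C"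
| beta_unit: "\<lbrakk>Unit i # \<Gamma> \<turnstile> C \<Colon> Univ k; \<Gamma> \<turnstile> c \<Colon> inst (Star i) C\<rbrakk>
    \<Longrightarrow> \<Gamma> \<turnstile> UnitRec C c (Star i) \<doteq> c \<Colon> inst (Star i) C"
| beta_zero: "\<lbrakk>NatT i # \<Gamma> \<turnstile> C \<Colon> Univ k; \<Gamma> \<turnstile> c \<Colon> inst (Zero i) C;
    C # NatT i # \<Gamma> \<turnstile> d \<Colon> subst (Succ (Var 1) ## sh 2) C\<rbrakk>
    \<Longrightarrow> \<Gamma> \<turnstile> NatRec C c d (Zero i) \<doteq> c \<Colon> inst (Zero i) C"
| beta_succ: "\<lbrakk>NatT i # \<Gamma> \<turnstile> C \<Colon> Univ k; \<Gamma> \<turnstile> c \<Colon> inst (Zero i) C;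
    C # NatT i # \<Gamma> \<turnstile> d \<Colon> subst (Succ (Var 1) ## sh 2) C; \<Gamma> \<turnstile> n \<Colon> NatT i\<rbrakk>
    \<Longrightarrow> \<Gamma> \<turnstile> NatRec C c d (Succ n) \<doteq> subst (NatRec C c d n ## n ## Var) d \<Colon> inst (Succ n) C"
| beta_j: "\<lbrakk>IdT (wk 2 A) (Var 1) (Var 0) # wk 1 A # A # \<Gamma> \<turnstile> C \<Colon> Univ k;
    A # \<Gamma> \<turnstile> c \<Colon> subst (Rfl (Var 0) ## Var 0 ## Var 0 ## sh 1) C; \<Gamma> \<turnstile> a \<Colon> A\<rbrakk>
    \<Longrightarrow> \<Gamma> \<turnstile> J C c a a (Rfl a) \<doteq> inst a c \<Colon> subst (Rfl a ## a ## a ## Var) C"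

| cong_pi: "\<lbrakk>\<Gamma> \<turnstile> A \<doteq> A' \<Colon> Univ i; A # \<Gamma> \<turnstile> B \<doteq> B' \<Colon> Univ j\<rbrakk>
    \<Longrightarrow> \<Gamma> \<turnstile> Pi A B \<doteq> Pi A' B' \<Colon> Univ (sup i j)"
| cong_lam: "\<lbrakk>\<Gamma> \<turnstile> A \<doteq> A' \<Colon> Univ i; A # \<Gamma> \<turnstile> b \<doteq> b' \<Colon> B\<rbrakk>
    \<Longrightarrow> \<Gamma> \<turnstile> Lam A b \<doteq> Lam A' b' \<Colon> Pi A B"
| cong_app: "\<lbrakk>\<Gamma> \<turnstile> f \<doteq> f' \<Colon> Pi A B; \<Gamma> \<turnstile> a \<doteq> a' \<Colon> A\<rbrakk>
    \<Longrightarrow> \<Gamma> \<turnstile> App f a \<doteq> App f' a' \<Colon> inst a B"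
| cong_sig: "\<lbrakk>\<Gamma> \<turnstile> A \<doteq> A' \<Colon> Univ i; A # \<Gamma> \<turnstile> B \<doteq> B' \<Colon> Univ j\<rbrakk>
    \<Longrightarrow> \<Gamma> \<turnstile> Sig A B \<doteq> Sig A' B' \<Colon> Univ (sup i j)"
| cong_pr: "\<lbrakk>A # \<Gamma> \<turnstile> B \<Colon> Univ j; \<Gamma> \<turnstile> a \<doteq> a' \<Colon> A; \<Gamma> \<turnstile> b \<doteq> b' \<Colon> inst a B\<rbrakk>
    \<Longrightarrow> \<Gamma> \<turnstile> Pr a b \<doteq> Pr a' b' \<Colon> Sig A B"
| cong_split: "\<lbrakk>Sig A B # \<Gamma> \<turnstile> C \<doteq> C' \<Colon> Univ k;
    B # A # \<Gamma> \<turnstile> d \<doteq> d' \<Colon> subst (Pr (Var 1) (Var 0) ## sh 2) C;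
    \<Gamma> \<turnstile> p \<doteq> p' \<Colon> Sig A B\<rbrakk> \<Longrightarrow> \<Gamma> \<turnstile> Split C d p \<doteq> Split C' d' p' \<Colon> inst p C"
| cong_plus: "\<lbrakk>\<Gamma> \<turnstile> A \<doteq> A' \<Colon> Univ i; \<Gamma> \<turnstile> B \<doteq> B' \<Colon> Univ j\<rbrakk>
    \<Longrightarrow> \<Gamma> \<turnstile> Plus A B \<doteq> Plus A' B' \<Colon> Univ (sup i j)"
| cong_inl: "\<lbrakk>\<Gamma> \<turnstile> a \<doteq> a' \<Colon> A; \<Gamma> \<turnstile> B \<Colon> Univ j\<rbrakk> \<Longrightarrow> \<Gamma> \<turnstile> InL a \<doteq> InL a' \<Colon> Plus A B"
| cong_inr: "\<lbrakk>\<Gamma> \<turnstile> A \<Colon> Univ i; \<Gamma> \<turnstile> b \<doteq> b' \<Colon> B\<rbrakk> \<Longrightarrow> \<Gamma> \<turnstile> InR b \<doteq> InR b' \<Colon> Plus A B"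
| cong_cases: "\<lbrakk>Plus A B # \<Gamma> \<turnstile> C \<doteq> C' \<Colon> Univ k;
    A # \<Gamma> \<turnstile> c \<doteq> c' \<Colon> subst (InL (Var 0) ## sh 1) C;
    B # \<Gamma> \<turnstile> d \<doteq> d' \<Colon> subst (InR (Var 0) ## sh 1) C;
    \<Gamma> \<turnstile> s \<doteq> s' \<Colon> Plus A B\<rbrakk> \<Longrightarrow> \<Gamma> \<turnstile> Cases C c d s \<doteq> Cases C' c' d' s' \<Colon> inst s C"
| cong_absurd: "\<lbrakk>Empty i # \<Gamma> \<turnstile> C \<doteq> C' \<Colon> Univ k; \<Gamma> \<turnstile> e \<doteq> e' \<Colon> Empty i\<rbrakk>
    \<Longrightarrow> \<Gamma> \<turnstile> Absurd C e \<doteq> Absurd C' e' \<Colon> inst e C"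
| cong_unitrec: "\<lbrakk>Unit i # \<Gamma> \<turnstile> C \<doteq> C' \<Colon> Univ k; \<Gamma> \<turnstile> c \<doteq> c' \<Colon> inst (Star i) C;
    \<Gamma> \<turnstile> u \<doteq> u' \<Colon> Unit i\<rbrakk> \<Longrightarrow> \<Gamma> \<turnstile> UnitRec C c u \<doteq> UnitRec C' c' u' \<Colon> inst u C"
| cong_succ: "\<Gamma> \<turnstile> n \<doteq> n' \<Colon> NatT i \<Longrightarrow> \<Gamma> \<turnstile> Succ n \<doteq> Succ n' \<Colon> NatT i"
| cong_natrec: "\<lbrakk>NatT i # \<Gamma> \<turnstile> C \<doteq> C' \<Colon> Univ k; \<Gamma> \<turnstile> c \<doteq> c' \<Colon> inst (Zero i) C;
    C # NatT i # \<Gamma> \<turnstile> d \<doteq> d' \<Colon> subst (Succ (Var 1) ## sh 2) C; \<Gamma> \<turnstile> n \<doteq> n' \<Colon> NatT i\<rbrakk>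
    \<Longrightarrow> \<Gamma> \<turnstile> NatRec C c d n \<doteq> NatRec C' c' d' n' \<Colon> inst n C"
| cong_id: "\<lbrakk>\<Gamma> \<turnstile> A \<doteq> A' \<Colon> Univ i; \<Gamma> \<turnstile> a \<doteq> a' \<Colon> A; \<Gamma> \<turnstile> b \<doteq> b' \<Colon> A\<rbrakk>
    \<Longrightarrow> \<Gamma> \<turnstile> IdT A a b \<doteq> IdT A' a' b' \<Colon> Univ i"
| cong_rfl: "\<Gamma> \<turnstile> a \<doteq> a' \<Colon> A \<Longrightarrow> \<Gamma> \<turnstile> Rfl a \<doteq> Rfl a' \<Colon> IdT A a a"
| cong_j: "\<lbrakk>IdT (wk 2 A) (Var 1) (Var 0) # wk 1 A # A # \<Gamma> \<turnstile> C \<doteq> C' \<Colon> Univ k;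
    A # \<Gamma> \<turnstile> c \<doteq> c' \<Colon> subst (Rfl (Var 0) ## Var 0 ## Var 0 ## sh 1) C;
    \<Gamma> \<turnstile> a \<doteq> a' \<Colon> A; \<Gamma> \<turnstile> b \<doteq> b' \<Colon> A; \<Gamma> \<turnstile> p \<doteq> p' \<Colon> IdT A a b\<rbrakk>
    \<Longrightarrow> \<Gamma> \<turnstile> J C c a b p \<doteq> J C' c' a' b' p' \<Colon> subst (p ## b ## a ## Var) C"

text \<open>A proposition of the object theory holds if there is a closed term of that type.\<close>

definition inhabited :: "'l::universe_level tm \<Rightarrow> bool"
  where "inhabited A \<longleftrightarrow> (\<exists>t. [] \<turnstile> t \<Colon> A)"

end

theory Submission
  imports Defs
begin

text \<open>
  If every pointed type is injective, apply this to \<open>D = P + \<one>\<close>, pointed by \<open>inr \<star>\<close>, for a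
  proposition \<open>P\<close>: the constant map \<open>P \<rightarrow> \<one>\<close> is an embedding, so \<open>inl : P \<rightarrow> D\<close> extends to some
  \<open>g : \<one> \<rightarrow> D\<close>.  If \<open>g \<star>\<close> is an \<open>inl p\<close>, then \<open>P\<close> holds; if it is an \<open>inr t\<close>, then any \<open>p : P\<close>
  would give \<open>inl p = g \<star> = inr t\<close>, so \<open>P\<close> is empty.  Taking \<open>P\<close> itself as the domain, rather than
  \<open>P + \<not>P\<close>, avoids function extensionality.  Conversely, given excluded middle, an embedding \<open>j\<close>
  and a point \<open>d : D\<close>, extend \<open>f\<close> by \<open>g y = f x\<close> if the fiber of \<open>j\<close> over \<open>y\<close> is inhabited by \<open>x\<close>,
    and
  \<open>g y = d\<close> if it is empty.

  The witnesses are composed of closed terms, each typed in an arbitrary context, so neither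
  weakening nor substitution needs to be shown admissible.
\<close>

lemma scons_simps [simp]: "(t ## \<sigma>) 0 = t" "(t ## \<sigma>) (Suc n) = \<sigma> n"
  by (simp_all add: scons_def)

lemma upr_simps [simp]: "upr \<xi> 0 = 0" "upr \<xi> (Suc n) = Suc (\<xi> n)"
  by (simp_all add: upr_def)

lemma up_simps [simp]: "up \<sigma> 0 = Var 0" "up \<sigma> (Suc n) = rename Suc (\<sigma> n)"
  by (simp_all add: up_def)

text \<open>Marks a place where the type of \<open>t\<close> has to be converted to \<open>T\<close>.\<close>

definition ascribe :: "'l tm \<Rightarrow> 'l tm \<Rightarrow> 'l tm"
  where "ascribe T t = t"

lemma ascribe_simps [simp]:
  "rename \<xi> (ascribe T t) = ascribe (rename \<xi> T) (rename \<xi> t)"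
  "subst \<sigma> (ascribe T t) = ascribe (subst \<sigma> T) (subst \<sigma> t)"
  by (simp_all add: ascribe_def)

primrec apps :: "'l tm \<Rightarrow> 'l tm list \<Rightarrow> 'l tm" where
  "apps f [] = f"
| "apps f (a # as) = apps (App f a) as"

text \<open>Rewrites the indices in an instantiated rule to the form that the simplifier produces
  in goals.\<close>

lemmas unary = eval_nat_numeral BitM.simps numeral_One One_nat_def

lemmas unfold_syntax = wk_def sh_def inst_def eval_nat_numeral
  Arr_def idf_def Fst_def is_subsingleton_def fiber_def is_embedding_def Emb_def
  pointwise_eq_def comp_def alg_injective_def all_pointed_alg_injective_def excluded_middle_def

section \<open>Algorithmic typing and conversion\<close>

text \<open>
  The type is a separate variable, so that each rule both infers and checks when applied backwards.
  Contexts extended by a binder come with the hypothesis that they are well formed; rederiving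
  this at every leaf would make the search exponential.
\<close>

lemma r_var: "\<lbrakk>\<Gamma> \<turnstile> ctx; n < length \<Gamma>; T = wk (Suc n) (\<Gamma> ! n)\<rbrakk> \<Longrightarrow> \<Gamma> \<turnstile> Var n \<Colon> T"
  by (simp add: ty_var)

lemma r_ascribe: "\<lbrakk>T = T'; \<Gamma> \<turnstile> t \<Colon> S; \<Gamma> \<turnstile> S \<doteq> T \<Colon> Univ i\<rbrakk> \<Longrightarrow> \<Gamma> \<turnstile> ascribe T t \<Colon> T'"
  unfolding ascribe_def using ty_conv by auto

lemma r_univ: "\<lbrakk>\<Gamma> \<turnstile> ctx; T = Univ (lsuc i)\<rbrakk> \<Longrightarrow> \<Gamma> \<turnstile> Univ i \<Colon> T"
  by (simp add: ty_univ)

lemma r_pi: "\<lbrakk>\<Gamma> \<turnstile> ctx; \<Gamma> \<turnstile> A \<Colon> K; K = Univ i; A # \<Gamma> \<turnstile> ctx \<Longrightarrow> A # \<Gamma> \<turnstile> B \<Colon> L; L = Univ j;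
    T = Univ (sup i j)\<rbrakk> \<Longrightarrow> \<Gamma> \<turnstile> Pi A B \<Colon> T"
  by (simp add: ty_pi ctx_cons)

lemma r_sig: "\<lbrakk>\<Gamma> \<turnstile> ctx; \<Gamma> \<turnstile> A \<Colon> K; K = Univ i; A # \<Gamma> \<turnstile> ctx \<Longrightarrow> A # \<Gamma> \<turnstile> B \<Colon> L; L = Univ j;
    T = Univ (sup i j)\<rbrakk> \<Longrightarrow> \<Gamma> \<turnstile> Sig A B \<Colon> T"
  by (simp add: ty_sig ctx_cons)

lemma r_plus: "\<lbrakk>\<Gamma> \<turnstile> A \<Colon> K; K = Univ i; \<Gamma> \<turnstile> B \<Colon> L; L = Univ j; T = Univ (sup i j)\<rbrakk>
    \<Longrightarrow> \<Gamma> \<turnstile> Plus A B \<Colon> T"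
  by (simp add: ty_plus)

lemma r_id: "\<lbrakk>\<Gamma> \<turnstile> A \<Colon> K; K = Univ i; \<Gamma> \<turnstile> a \<Colon> A; \<Gamma> \<turnstile> b \<Colon> A; T = Univ i\<rbrakk> \<Longrightarrow> \<Gamma> \<turnstile> IdT A a b \<Colon> T"
  by (simp add: ty_id)

lemma r_empty: "\<lbrakk>\<Gamma> \<turnstile> ctx; T = Univ i\<rbrakk> \<Longrightarrow> \<Gamma> \<turnstile> Empty i \<Colon> T"
  by (simp add: ty_empty)

lemma r_unit: "\<lbrakk>\<Gamma> \<turnstile> ctx; T = Univ i\<rbrakk> \<Longrightarrow> \<Gamma> \<turnstile> Unit i \<Colon> T"
  by (simp add: ty_unit)

lemma r_star: "\<lbrakk>\<Gamma> \<turnstile> ctx; T = Unit i\<rbrakk> \<Longrightarrow> \<Gamma> \<turnstile> Star i \<Colon> T"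
  by (simp add: ty_star)

lemma r_lam: "\<lbrakk>\<Gamma> \<turnstile> ctx; T = Pi A B; \<Gamma> \<turnstile> A \<Colon> K; K = Univ i; A # \<Gamma> \<turnstile> ctx \<Longrightarrow> A # \<Gamma> \<turnstile> b \<Colon> B\<rbrakk>
    \<Longrightarrow> \<Gamma> \<turnstile> Lam A b \<Colon> T"
  by (simp add: ty_lam ctx_cons)

lemma r_app: "\<lbrakk>\<Gamma> \<turnstile> f \<Colon> F; F = Pi A B; \<Gamma> \<turnstile> a \<Colon> A; T = inst a B\<rbrakk> \<Longrightarrow> \<Gamma> \<turnstile> App f a \<Colon> T"
  by (simp add: ty_app)

lemma r_pr: "\<lbrakk>\<Gamma> \<turnstile> ctx; T = Sig A B; \<Gamma> \<turnstile> A \<Colon> K; K = Univ i; A # \<Gamma> \<turnstile> ctx \<Longrightarrow> A # \<Gamma> \<turnstile> B \<Colon> L; L = Univ j;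
    \<Gamma> \<turnstile> a \<Colon> A; S = inst a B; \<Gamma> \<turnstile> b \<Colon> S\<rbrakk> \<Longrightarrow> \<Gamma> \<turnstile> Pr a b \<Colon> T"
  by (simp add: ty_pr ctx_cons)

lemma r_split: "\<lbrakk>\<Gamma> \<turnstile> ctx; \<Gamma> \<turnstile> p \<Colon> P; P = Sig A B; \<Gamma> \<turnstile> A \<Colon> K; K = Univ i;
    A # \<Gamma> \<turnstile> ctx \<Longrightarrow> A # \<Gamma> \<turnstile> B \<Colon> L; L = Univ j;
    Sig A B # \<Gamma> \<turnstile> ctx \<Longrightarrow> Sig A B # \<Gamma> \<turnstile> C \<Colon> M; M = Univ k;
    S = subst (Pr (Var 1) (Var 0) ## sh 2) C;
    B # A # \<Gamma> \<turnstile> ctx \<Longrightarrow> B # A # \<Gamma> \<turnstile> d \<Colon> S; T = inst p C\<rbrakk> \<Longrightarrow> \<Gamma> \<turnstile> Split C d p \<Colon> T"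
  by (metis ctx_cons ty_sig ty_split)

lemma r_inl: "\<lbrakk>T = Plus A B; \<Gamma> \<turnstile> a \<Colon> A; \<Gamma> \<turnstile> B \<Colon> L; L = Univ j\<rbrakk> \<Longrightarrow> \<Gamma> \<turnstile> InL a \<Colon> T"
  by (simp add: ty_inl)

lemma r_inr: "\<lbrakk>T = Plus A B; \<Gamma> \<turnstile> A \<Colon> K; K = Univ i; \<Gamma> \<turnstile> b \<Colon> B\<rbrakk> \<Longrightarrow> \<Gamma> \<turnstile> InR b \<Colon> T"
  by (simp add: ty_inr)

lemma r_cases: "\<lbrakk>\<Gamma> \<turnstile> ctx; \<Gamma> \<turnstile> s \<Colon> P; P = Plus A B; \<Gamma> \<turnstile> A \<Colon> K; K = Univ i; \<Gamma> \<turnstile> B \<Colon> L; L = Univ j;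
    Plus A B # \<Gamma> \<turnstile> ctx \<Longrightarrow> Plus A B # \<Gamma> \<turnstile> C \<Colon> M; M = Univ k;
    S = subst (InL (Var 0) ## sh 1) C; A # \<Gamma> \<turnstile> ctx \<Longrightarrow> A # \<Gamma> \<turnstile> c \<Colon> S;
    S' = subst (InR (Var 0) ## sh 1) C; B # \<Gamma> \<turnstile> ctx \<Longrightarrow> B # \<Gamma> \<turnstile> d \<Colon> S';
    T = inst s C\<rbrakk> \<Longrightarrow> \<Gamma> \<turnstile> Cases C c d s \<Colon> T"
  by (metis ctx_cons ty_plus ty_cases)

lemma r_absurd: "\<lbrakk>\<Gamma> \<turnstile> ctx; \<Gamma> \<turnstile> e \<Colon> P; P = Empty i; Empty i # \<Gamma> \<turnstile> ctx \<Longrightarrow> Empty i # \<Gamma> \<turnstile> C \<Colon> M;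
  M = Univ k;
    T = inst e C\<rbrakk> \<Longrightarrow> \<Gamma> \<turnstile> Absurd C e \<Colon> T"
  by (metis ctx_cons ty_empty ty_absurd)

lemma r_unitrec: "\<lbrakk>\<Gamma> \<turnstile> ctx; \<Gamma> \<turnstile> t \<Colon> P; P = Unit i; Unit i # \<Gamma> \<turnstile> ctx \<Longrightarrow> Unit i # \<Gamma> \<turnstile> C \<Colon> M;
  M = Univ k;
    S = inst (Star i) C; \<Gamma> \<turnstile> c \<Colon> S; T = inst t C\<rbrakk> \<Longrightarrow> \<Gamma> \<turnstile> UnitRec C c t \<Colon> T"
  by (metis ctx_cons ty_unit ty_unitrec)

lemma r_rfl: "\<lbrakk>T = IdT A a a; \<Gamma> \<turnstile> a \<Colon> A\<rbrakk> \<Longrightarrow> \<Gamma> \<turnstile> Rfl a \<Colon> T"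
  by (simp add: ty_rfl)

lemma r_j: "\<lbrakk>\<Gamma> \<turnstile> ctx; \<Gamma> \<turnstile> p \<Colon> P; P = IdT A a b; \<Gamma> \<turnstile> A \<Colon> K; K = Univ i;
    A1 = wk 1 A; A # \<Gamma> \<turnstile> ctx \<Longrightarrow> A # \<Gamma> \<turnstile> A1 \<Colon> K1; K1 = Univ i1;
    A2 = wk 2 A; A1 # A # \<Gamma> \<turnstile> ctx \<Longrightarrow> A1 # A # \<Gamma> \<turnstile> A2 \<Colon> K2; K2 = Univ i2;
    A1 # A # \<Gamma> \<turnstile> ctx \<Longrightarrow> A1 # A # \<Gamma> \<turnstile> Var 1 \<Colon> A2; A1 # A # \<Gamma> \<turnstile> ctx \<Longrightarrow> A1 # A # \<Gamma> \<turnstile> Var 0 \<Colon> A2;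
    IdT A2 (Var 1) (Var 0) # A1 # A # \<Gamma> \<turnstile> ctx \<Longrightarrow> IdT A2 (Var 1) (Var 0) # A1 # A # \<Gamma> \<turnstile> C \<Colon> K3;
      K3 = Univ k;
    S = subst (Rfl (Var 0) ## Var 0 ## Var 0 ## sh 1) C; A # \<Gamma> \<turnstile> ctx \<Longrightarrow> A # \<Gamma> \<turnstile> c \<Colon> S;
    \<Gamma> \<turnstile> a \<Colon> A; \<Gamma> \<turnstile> b \<Colon> A; T = subst (p ## b ## a ## Var) C\<rbrakk> \<Longrightarrow> \<Gamma> \<turnstile> J C c a b p \<Colon> T"
  using ty_j[of A \<Gamma> C k c a b p] ctx_cons ty_id by blast

text \<open>
  Reflexivity only at constructors: an equation with an unevaluated substitution on its right-hand
  side is left to the simplifier, so that inferred types are in normal form.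
\<close>

lemma match_head:
  "Pi A B = Pi A B" "Univ i = Univ i" "Sig A B = Sig A B" "Plus A B = Plus A B"
  "IdT A a b = IdT A a b" "Unit i = Unit i" "Empty i = Empty i"
  by (rule refl)+

lemmas typing = match_head r_var r_ascribe r_univ r_pi r_sig r_plus r_id r_empty r_unit r_star
  r_lam r_app r_pr
  r_split r_inl r_inr r_cases r_absurd r_unitrec r_rfl r_j

section \<open>Conversion rules\<close>

lemma q_pi: "\<lbrakk>\<Gamma> \<turnstile> ctx; \<Gamma> \<turnstile> A \<Colon> K; K = Univ i; A # \<Gamma> \<turnstile> ctx \<Longrightarrow> A # \<Gamma> \<turnstile> B \<doteq> B' \<Colon> L; L = Univ j;
    T = Univ (sup i j)\<rbrakk> \<Longrightarrow> \<Gamma> \<turnstile> Pi A B \<doteq> Pi A B' \<Colon> T"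
  by (simp add: cong_pi eq_refl ctx_cons)

lemma q_sig: "\<lbrakk>\<Gamma> \<turnstile> ctx; \<Gamma> \<turnstile> A \<Colon> K; K = Univ i; A # \<Gamma> \<turnstile> ctx \<Longrightarrow> A # \<Gamma> \<turnstile> B \<doteq> B' \<Colon> L; L = Univ j;
    T = Univ (sup i j)\<rbrakk> \<Longrightarrow> \<Gamma> \<turnstile> Sig A B \<doteq> Sig A B' \<Colon> T"
  by (simp add: cong_sig eq_refl ctx_cons)

lemma q_id: "\<lbrakk>\<Gamma> \<turnstile> A \<Colon> K; K = Univ i; \<Gamma> \<turnstile> a \<doteq> a' \<Colon> A; \<Gamma> \<turnstile> b \<doteq> b' \<Colon> A; T = Univ i\<rbrakk>
    \<Longrightarrow> \<Gamma> \<turnstile> IdT A a b \<doteq> IdT A a' b' \<Colon> T"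
  by (simp add: cong_id eq_refl)

lemma q_app: "\<lbrakk>\<Gamma> \<turnstile> f \<doteq> f' \<Colon> F; F = Pi A B; \<Gamma> \<turnstile> a \<doteq> a' \<Colon> A; T = inst a B\<rbrakk>
    \<Longrightarrow> \<Gamma> \<turnstile> App f a \<doteq> App f' a' \<Colon> T"
  by (simp add: cong_app)

text \<open>Contracts the left-hand redex and goes on with the reduct, so that backward application
  performs evaluation.\<close>

lemma q_app_beta_left: "\<lbrakk>\<Gamma> \<turnstile> ctx; \<Gamma> \<turnstile> A \<Colon> K; K = Univ i; A # \<Gamma> \<turnstile> ctx \<Longrightarrow> A # \<Gamma> \<turnstile> b \<Colon> B;
    \<Gamma> \<turnstile> a \<Colon> A; T = inst a B; r = inst a b; \<Gamma> \<turnstile> r \<doteq> c \<Colon> T\<rbrakk> \<Longrightarrow> \<Gamma> \<turnstile> App (Lam A b) a \<doteq> c \<Colon> T"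
  by (metis beta_pi ctx_cons eq_trans)

lemma q_app_beta_right: "\<lbrakk>\<Gamma> \<turnstile> ctx; \<Gamma> \<turnstile> A \<Colon> K; K = Univ i; A # \<Gamma> \<turnstile> ctx \<Longrightarrow> A # \<Gamma> \<turnstile> b \<Colon> B;
    \<Gamma> \<turnstile> a \<Colon> A; T = inst a B; r = inst a b; \<Gamma> \<turnstile> c \<doteq> r \<Colon> T\<rbrakk> \<Longrightarrow> \<Gamma> \<turnstile> c \<doteq> App (Lam A b) a \<Colon> T"
  by (metis beta_pi ctx_cons eq_trans eq_sym)

text \<open>
  Pairs and injections do not determine their type; in the rules below \<open>E\<close> supplies it where it
  would have to be inferred.
\<close>

lemma r_split_at: "\<lbrakk>P = E; \<Gamma> \<turnstile> ctx; \<Gamma> \<turnstile> p \<Colon> P; P = Sig A B; \<Gamma> \<turnstile> A \<Colon> K; K = Univ i;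
    A # \<Gamma> \<turnstile> ctx \<Longrightarrow> A # \<Gamma> \<turnstile> B \<Colon> L; L = Univ j;
    Sig A B # \<Gamma> \<turnstile> ctx \<Longrightarrow> Sig A B # \<Gamma> \<turnstile> C \<Colon> M; M = Univ k;
    S = subst (Pr (Var 1) (Var 0) ## sh 2) C;
    B # A # \<Gamma> \<turnstile> ctx \<Longrightarrow> B # A # \<Gamma> \<turnstile> d \<Colon> S; T = inst p C\<rbrakk> \<Longrightarrow> \<Gamma> \<turnstile> Split C d p \<Colon> T"
  by (rule r_split)

lemma r_inr_at: "\<lbrakk>P = E; P = Plus A B; \<Gamma> \<turnstile> A \<Colon> K; K = Univ i; \<Gamma> \<turnstile> b \<Colon> B; T = P\<rbrakk> \<Longrightarrow> \<Gamma> \<turnstile> InR b \<Colon> T"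
  using ty_inr by blast

lemma q_app_head: "\<lbrakk>\<Gamma> \<turnstile> f \<doteq> f' \<Colon> F; F = Pi A B; \<Gamma> \<turnstile> a \<Colon> A; T = inst a B; \<Gamma> \<turnstile> App f' a \<doteq> c \<Colon> T\<rbrakk>
    \<Longrightarrow> \<Gamma> \<turnstile> App f a \<doteq> c \<Colon> T"
  by (meson eq_refl eq_trans q_app)

lemma q_split_beta: "\<lbrakk>P = E; P = Sig A B; \<Gamma> \<turnstile> ctx; \<Gamma> \<turnstile> A \<Colon> K; K = Univ i;
    A # \<Gamma> \<turnstile> ctx \<Longrightarrow> A # \<Gamma> \<turnstile> B \<Colon> L; L = Univ j;
    Sig A B # \<Gamma> \<turnstile> ctx \<Longrightarrow> Sig A B # \<Gamma> \<turnstile> C \<Colon> M; M = Univ k;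
    S = subst (Pr (Var 1) (Var 0) ## sh 2) C;
    B # A # \<Gamma> \<turnstile> ctx \<Longrightarrow> B # A # \<Gamma> \<turnstile> d \<Colon> S;
    \<Gamma> \<turnstile> a \<Colon> A; S' = inst a B; \<Gamma> \<turnstile> b \<Colon> S'; r = subst (b ## a ## Var) d; T = inst (Pr a b) C\<rbrakk>
    \<Longrightarrow> \<Gamma> \<turnstile> Split C d (Pr a b) \<doteq> r \<Colon> T"
  by (metis ctx_cons ty_sig beta_sig)

lemma q_cases_inl: "\<lbrakk>P = E; P = Plus A B; \<Gamma> \<turnstile> ctx; \<Gamma> \<turnstile> A \<Colon> K; K = Univ i; \<Gamma> \<turnstile> B \<Colon> L; L = Univ j;
    Plus A B # \<Gamma> \<turnstile> ctx \<Longrightarrow> Plus A B # \<Gamma> \<turnstile> C \<Colon> M; M = Univ k;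
    S = subst (InL (Var 0) ## sh 1) C; A # \<Gamma> \<turnstile> ctx \<Longrightarrow> A # \<Gamma> \<turnstile> c \<Colon> S;
    S' = subst (InR (Var 0) ## sh 1) C; B # \<Gamma> \<turnstile> ctx \<Longrightarrow> B # \<Gamma> \<turnstile> d \<Colon> S';
    \<Gamma> \<turnstile> a \<Colon> A; r = inst a c; T = inst (InL a) C\<rbrakk> \<Longrightarrow> \<Gamma> \<turnstile> Cases C c d (InL a) \<doteq> r \<Colon> T"
  by (metis ctx_cons ty_plus beta_inl)

lemma q_cases_inr: "\<lbrakk>P = E; P = Plus A B; \<Gamma> \<turnstile> ctx; \<Gamma> \<turnstile> A \<Colon> K; K = Univ i; \<Gamma> \<turnstile> B \<Colon> L; L = Univ j;
    Plus A B # \<Gamma> \<turnstile> ctx \<Longrightarrow> Plus A B # \<Gamma> \<turnstile> C \<Colon> M; M = Univ k;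
    S = subst (InL (Var 0) ## sh 1) C; A # \<Gamma> \<turnstile> ctx \<Longrightarrow> A # \<Gamma> \<turnstile> c \<Colon> S;
    S' = subst (InR (Var 0) ## sh 1) C; B # \<Gamma> \<turnstile> ctx \<Longrightarrow> B # \<Gamma> \<turnstile> d \<Colon> S';
    \<Gamma> \<turnstile> b \<Colon> B; r = inst b d; T = inst (InR b) C\<rbrakk> \<Longrightarrow> \<Gamma> \<turnstile> Cases C c d (InR b) \<doteq> r \<Colon> T"
  by (metis ctx_cons ty_plus beta_inr)

lemma q_unitrec: "\<lbrakk>\<Gamma> \<turnstile> ctx; Unit i # \<Gamma> \<turnstile> ctx \<Longrightarrow> Unit i # \<Gamma> \<turnstile> C \<Colon> M; M = Univ k;
    S = inst (Star i) C; \<Gamma> \<turnstile> c \<Colon> S; T = S; \<Gamma> \<turnstile> c \<doteq> r \<Colon> T\<rbrakk> \<Longrightarrow> \<Gamma> \<turnstile> UnitRec C c (Star i) \<doteq> r \<Colon> T"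
  by (metis ctx_cons ty_unit beta_unit eq_trans)

section \<open>From injectivity to excluded middle\<close>

text \<open>Symmetry and transitivity in one path induction: from x = y and x = z to y = z.\<close>

definition id_euclid :: "'l \<Rightarrow> 'l tm"
  where "id_euclid u = Lam (Univ u) (Lam (Var 0)
    (Lam (Var 1) (Lam (Var 2) (Lam (IdT (Var 3) (Var 2) (Var 1))
    (J (Arr (IdT (Var 7) (Var 2) (Var 4)) (IdT (Var 7) (Var 1) (Var 4)))
      (idf (IdT (Var 5) (Var 0) (Var 2)))
      (Var 3) (Var 2) (Var 0))))))"

text \<open>As simp rules, these keep the witness folded when a substitution reaches it.\<close>

lemma id_euclid_closed [simp]:
  "rename \<xi> (id_euclid u) = id_euclid u"
  "subst \<sigma> (id_euclid u) = id_euclid u"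
  by (simp_all add: id_euclid_def unfold_syntax)

lemma id_euclid:
  assumes "\<Gamma> \<turnstile> ctx"
    and "T = Pi (Univ u) (Pi (Var 0) (Pi (Var 1) (Pi (Var 2)
      (Arr (IdT (Var 3) (Var 2) (Var 1)) (Arr (IdT (Var 3) (Var 2) (Var 0))
        (IdT (Var 3) (Var 1) (Var 0)))))))"
  shows "\<Gamma> \<turnstile> id_euclid u \<Colon> T"
  using assms unfolding id_euclid_def
  apply (simp add: unfold_syntax)
  apply (assumption | rule typing | (simp (no_asm) add: unfold_syntax; fail))+
  done

text \<open>
  Disjointness of the summands of \<open>P + \<one>\<close>: transport along \<open>inl p = inr t\<close> in the family that is
  \<open>\<one>\<close> on \<open>inl\<close> and \<open>\<zero>\<close> on \<open>inr\<close>.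
\<close>

definition code :: "'l \<Rightarrow> 'l tm \<Rightarrow> 'l tm"
  where "code u s = Cases (Univ u) (Unit u) (Empty u) s"

definition disjoint :: "'l \<Rightarrow> 'l tm"
  where "disjoint u = Lam (Univ u) (Lam (Var 0)
    (Lam (Unit u) (Lam (IdT (Plus (Var 2) (Unit u)) (InL (Var 1)) (InR (Var 0)))
    (ascribe (Empty u) (App (J (Arr (code u (Var 2)) (code u (Var 1)))
      (idf (code u (Var 0))) (InL (Var 2)) (InR (Var 1)) (Var 0))
      (ascribe (code u (InL (Var 2))) (Star u)))))))"

lemma disjoint_closed [simp]:
  "rename \<xi> (disjoint u) = disjoint u"
  "subst \<sigma> (disjoint u) = disjoint u"
  by (simp_all add: disjoint_def code_def unfold_syntax)

lemma disjoint:
  assumes "\<Gamma> \<turnstile> ctx"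
    and "T = Pi (Univ u) (Pi (Var 0) (Pi (Unit u)
      (Arr (IdT (Plus (Var 2) (Unit u)) (InL (Var 1)) (InR (Var 0))) (Empty u))))"
  shows "\<Gamma> \<turnstile> disjoint u \<Colon> T"
  using assms unfolding disjoint_def
  apply (simp add: unfold_syntax code_def)
  apply (assumption | rule typing | (simp (no_asm) add: unfold_syntax; fail))+
  \<comment> \<open>Inner ascription: \<open>code\<close> at \<open>InL\<close> computes to
    \<open>Unit u\<close>, the type of \<open>Star u\<close>.\<close>
  apply (rule eq_sym, rule q_cases_inl[where E="Plus (Var 3) (Unit u)"])
  apply (assumption | rule typing | (simp (no_asm) add: unfold_syntax; fail))+
  \<comment> \<open>Outer ascription: \<open>code\<close> at \<open>InR\<close> computes to
    \<open>Empty u\<close>.\<close>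
  apply (rule q_cases_inr[where E="Plus (Var 3) (Unit u)"])
  apply (assumption | rule typing | (simp (no_asm) add: unfold_syntax; fail))+
  done

text \<open>
  \<open>unit_path \<star> \<star>\<close> computes to \<open>refl\<close>, so path induction identifies every path of \<open>\<one>\<close> with
  \<open>unit_path\<close>; hence \<open>\<one>\<close> is a set.
\<close>

definition unit_path :: "'l \<Rightarrow> 'l tm \<Rightarrow> 'l tm \<Rightarrow> 'l tm"
  where "unit_path u a b = UnitRec (IdT (Unit u) (Var 0) (wk 1 b))
    (UnitRec (IdT (Unit u) (Star u) (Var 0)) (Rfl (Star u)) b) a"

definition unit_path_unique :: "'l \<Rightarrow> 'l tm"
  where "unit_path_unique u = Lam (Unit u) (Lam (Unit u) (Lam (IdT (Unit u) (Var 1) (Var 0))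
    (J (IdT (IdT (Unit u) (Var 2) (Var 1)) (unit_path u (Var 2) (Var 1)) (Var 0))
      (UnitRec (IdT (IdT (Unit u) (Var 0) (Var 0)) (unit_path u (Var 0) (Var 0)) (Rfl (Var 0)))
        (ascribe (IdT (IdT (Unit u) (Star u) (Star u))
          (unit_path u (Star u) (Star u)) (Rfl (Star u))) (Rfl (Rfl (Star u)))) (Var 0))
      (Var 2) (Var 1) (Var 0))))"

lemma unit_path_unique_closed [simp]:
  "rename \<xi> (unit_path_unique u) = unit_path_unique u"
  "subst \<sigma> (unit_path_unique u) = unit_path_unique u"
  by (simp_all add: unit_path_unique_def unit_path_def unfold_syntax)

lemma unit_path_unique:
  assumes "\<Gamma> \<turnstile> ctx"
    and "T = Pi (Unit u) (Pi (Unit u) (Pi (IdT (Unit u) (Var 1) (Var 0))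
      (IdT (IdT (Unit u) (Var 2) (Var 1)) (unit_path u (Var 2) (Var 1)) (Var 0))))"
  shows "\<Gamma> \<turnstile> unit_path_unique u \<Colon> T"
  using assms unfolding unit_path_unique_def
  apply (simp add: unfold_syntax unit_path_def)
  apply (assumption | rule typing | (simp (no_asm) add: unfold_syntax; fail))+
  \<comment> \<open>The ascription remains; two \<open>UnitRec\<close> reductions take
    \<open>unit_path u (Star u) (Star u)\<close> to \<open>Rfl (Star u)\<close>.\<close>
  apply (rule eq_sym)
  apply (assumption | rule typing eq_refl q_id q_unitrec |
    (simp (no_asm) add: unfold_syntax; fail))+
  done

text \<open>Both paths equal the canonical \<open>unit_path\<close>, hence each other by
  \<open>id_euclid\<close>.\<close>

definition unit_paths_equal :: "'l \<Rightarrow> 'l tm"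
  where "unit_paths_equal u = Lam (Unit u) (Lam (Unit u)
    (Lam (IdT (Unit u) (Var 1) (Var 0)) (Lam (IdT (Unit u) (Var 2) (Var 1))
    (apps (id_euclid u) [IdT (Unit u) (Var 3) (Var 2), unit_path u (Var 3) (Var 2), Var 1, Var 0,
       apps (unit_path_unique u) [Var 3, Var 2, Var 1], apps
         (unit_path_unique u) [Var 3, Var 2, Var 0]]))))"

lemma unit_paths_equal_closed [simp]:
  "rename \<xi> (unit_paths_equal u) = unit_paths_equal u"
  "subst \<sigma> (unit_paths_equal u) = unit_paths_equal u"
  by (simp_all add: unit_paths_equal_def unit_path_def unfold_syntax)

lemma unit_paths_equal:
  assumes "\<Gamma> \<turnstile> ctx"
    and "T = Pi (Unit u) (Pi (Unit u) (Pi (IdT (Unit u) (Var 1) (Var 0))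
      (Pi (IdT (Unit u) (Var 2) (Var 1))
        (IdT (IdT (Unit u) (Var 3) (Var 2)) (Var 1) (Var 0)))))"
  shows "\<Gamma> \<turnstile> unit_paths_equal u \<Colon> T"
  using assms unfolding unit_paths_equal_def
  apply (simp add: unfold_syntax unit_path_def)
  apply (assumption | rule typing id_euclid unit_path_unique |
    (simp (no_asm) add: unfold_syntax unit_path_def; fail))+
  done

section \<open>The constant map from a proposition to the unit type is an embedding\<close>

definition const_map :: "'l \<Rightarrow> 'l tm \<Rightarrow> 'l tm"
  where "const_map u P = Lam P (Star u)"

definition const_map_fiber :: "'l \<Rightarrow> 'l tm \<Rightarrow> 'l tm \<Rightarrow> 'l tm"
  where "const_map_fiber u P y = fiber P (Unit u) (const_map u P) y"

text \<open>
  Path induction on \<open>x = x'\<close> reduces to two points \<open>(z, a)\<close> and \<open>(z, b)\<close>, where \<open>a = b\<close> since \<open>\<one>\<close>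
  is a set.
\<close>

definition const_map_fiber_equal :: "'l \<Rightarrow> 'l tm"
  where "const_map_fiber_equal u = Lam (Univ u) (Lam (is_subsingleton (Var 0)) (Lam (Unit u)
    (Lam (Var 2) (Lam (IdT (Unit u) (App (const_map u (Var 3)) (Var 0)) (Var 1))
    (Lam (Var 4) (Lam (IdT (Unit u) (App (const_map u (Var 5)) (Var 0)) (Var 3))
    (apps (J
      (Pi (IdT (Unit u) (App (const_map u (Var 9)) (Var 2)) (Var 7))
        (Pi (IdT (Unit u) (App (const_map u (Var 10)) (Var 2)) (Var 8))
          (IdT (const_map_fiber u (Var 11) (Var 9)) (Pr (Var 4) (Var 1)) (Pr (Var 3) (Var 0)))))
      (Lam (IdT (Unit u) (App (const_map u (Var 7)) (Var 0)) (Var 5))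
        (Lam (IdT (Unit u) (App (const_map u (Var 8)) (Var 1)) (Var 6))
          (J (IdT (const_map_fiber u (Var 12) (Var 10)) (Pr (Var 5) (Var 2)) (Pr (Var 5) (Var 1)))
            (Rfl (Pr (Var 3) (Var 0)))
            (Var 1) (Var 0)
            (apps (unit_paths_equal u) [App (const_map u (Var 9)) (Var 2), Var 7, Var 1, Var 0]))))
      (Var 3) (Var 1) (apps (Var 5) [Var 3, Var 1])) [Var 2, Var 0])))))))"

lemma const_map_fiber_equal_closed [simp]:
  "rename \<xi> (const_map_fiber_equal u) = const_map_fiber_equal u"
  "subst \<sigma> (const_map_fiber_equal u) = const_map_fiber_equal u"
  by (simp_all add: const_map_fiber_equal_def const_map_def const_map_fiber_def unfold_syntax)

lemma const_map_fiber_equal: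
  assumes "\<Gamma> \<turnstile> ctx"
    and "T = Pi (Univ u) (Pi (is_subsingleton (Var 0)) (Pi (Unit u)
    (Pi (Var 2) (Pi (IdT (Unit u) (App (const_map u (Var 3)) (Var 0)) (Var 1))
    (Pi (Var 4) (Pi (IdT (Unit u) (App (const_map u (Var 5)) (Var 0)) (Var 3))
      (IdT (const_map_fiber u (Var 6) (Var 4)) (Pr (Var 3) (Var 2)) (Pr (Var 1) (Var 0)))))))))"
  shows "\<Gamma> \<turnstile> const_map_fiber_equal u \<Colon> T"
  using assms unfolding const_map_fiber_equal_def
  apply (simp add: unfold_syntax const_map_def const_map_fiber_def)
  apply (assumption | rule typing unit_paths_equal | (simp (no_asm) add: unfold_syntax; fail))+
  done

text \<open>\<open>Sig\<close> has no eta rule, so both points of the fiber are split into pairs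
  rather than projected.\<close>

definition const_map_embedding :: "'l \<Rightarrow> 'l tm"
  where "const_map_embedding u = Lam (Univ u) (Lam (is_subsingleton (Var 0)) (Lam (Unit u)
    (Lam (const_map_fiber u (Var 2) (Var 0)) (Lam (const_map_fiber u (Var 3) (Var 1))
      (Split (IdT (const_map_fiber u (Var 5) (Var 3)) (Var 0) (Var 1))
        (Split (IdT (const_map_fiber u (Var 7) (Var 5)) (Pr (Var 2) (Var 1)) (Var 0))
          (apps (const_map_fiber_equal u) [Var 8, Var 7, Var 6, Var 3, Var 2, Var 1, Var 0])
          (Var 2))
        (Var 1))))))"

lemma const_map_embedding_closed [simp]:
  "rename \<xi> (const_map_embedding u) = const_map_embedding u"
  "subst \<sigma> (const_map_embedding u) = const_map_embedding u"
  by (simp_all add: const_map_embedding_def const_map_def const_map_fiber_def unfold_syntax)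

lemma const_map_embedding:
  assumes "\<Gamma> \<turnstile> ctx"
    and "T = Pi (Univ u) (Pi (is_subsingleton (Var 0))
      (is_embedding (Var 1) (Unit u) (const_map u (Var 1))))"
  shows "\<Gamma> \<turnstile> const_map_embedding u \<Colon> T"
  using assms unfolding const_map_embedding_def
  apply (simp add: unfold_syntax const_map_def const_map_fiber_def)
  apply (assumption | rule typing const_map_fiber_equal |
    (simp (no_asm) add: unfold_syntax const_map_def const_map_fiber_def; fail))+
  done

text \<open>The motive \<open>g \<star> = s \<rightarrow> \<dots>\<close> of the case distinction remembers the value of \<open>g \<star>\<close>.\<close>

definition decide :: "'l \<Rightarrow> 'l tm"
  where "decide u = Lam (Univ u) (Lam (Arr (Unit u) (Plus (Var 0) (Unit u)))
    (Lam (Pi (Var 1) (IdT (Plus (Var 2) (Unit u)) (App (Var 1) (Star u)) (InL (Var 0))))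
    (App (Cases (Pi (IdT (Plus (Var 3) (Unit u)) (App (Var 2) (Star u)) (Var 0))
      (Plus (Var 4) (Arr (Var 4) (Empty u))))
      (Lam (IdT (Plus (Var 3) (Unit u)) (App (Var 2) (Star u)) (InL (Var 0))) (InL (Var 1)))
      (Lam (IdT (Plus (Var 3) (Unit u)) (App (Var 2) (Star u)) (InR (Var 0)))
        (InR (Lam (Var 4) (apps (disjoint u) [Var 5, Var 0, Var 2,
          apps (id_euclid u) [Plus (Var 5) (Unit u), App (Var 4) (Star u), InL (Var 0),
            InR (Var 2), App (Var 3) (Var 0), Var 1]]))))
      (App (Var 1) (Star u))) (Rfl (App (Var 1) (Star u))))))"

lemma decide_closed [simp]:
  "rename \<xi> (decide u) = decide u"
  "subst \<sigma> (decide u) = decide u"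
  by (simp_all add: decide_def unfold_syntax)

lemma decide:
  assumes "\<Gamma> \<turnstile> ctx"
    and "T = Pi (Univ u) (Pi (Arr (Unit u) (Plus (Var 0) (Unit u)))
      (Arr (Pi (Var 1) (IdT (Plus (Var 2) (Unit u)) (App (Var 1) (Star u)) (InL (Var 0))))
        (Plus (Var 1) (Arr (Var 1) (Empty u)))))"
  shows "\<Gamma> \<turnstile> decide u \<Colon> T"
  using assms unfolding decide_def
  apply (simp add: unfold_syntax)
  apply (assumption | rule typing disjoint id_euclid | (simp (no_asm) add: unfold_syntax; fail))+
  done

text \<open>The ascription turns the extension law, stated with \<open>comp\<close> and
  \<open>Fst\<close>, into the form g \<star> = inl p that \<open>decide\<close> expects.\<close>

definition em_of_injective :: "'l \<Rightarrow> 'l tm"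
  where "em_of_injective u = Lam (all_pointed_alg_injective u)
    (Lam (Univ u) (Lam (is_subsingleton (Var 0))
    (Split (Plus (Var 2) (Arr (Var 2) (Empty u)))
      (apps (decide u) [Var 3, Var 1, ascribe
        (Pi (Var 3) (IdT (Plus (Var 4) (Unit u)) (App (Var 2) (Star u)) (InL (Var 0)))) (Var 0)])
      (apps (Var 2) [Plus (Var 1) (Unit u), InR (Star u), Var 1, Unit u, Pr (const_map u (Var 1))
        (apps (const_map_embedding u) [Var 1, Var 0]),
        Lam (Var 1) (InL (Var 0))]))))"

lemma em_of_injective:
  assumes "\<Gamma> \<turnstile> ctx"
    and "T = Arr (all_pointed_alg_injective u) (excluded_middle u)"
  shows "\<Gamma> \<turnstile> em_of_injective u \<Colon> T"
  using assms unfolding em_of_injective_def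
  apply (simp add: unfold_syntax const_map_def)
  apply (assumption | rule r_split_at[where E="Emb (Var 4) (Unit u)" and C="Pi (Var 5) (Unit u)",
    unfolded unary]
    r_lam[where A="Var 3" and b="InL (Var 0)" and B="Plus (Var 4) (Unit u)", unfolded unary]
      typing const_map_embedding decide | (simp (no_asm) add: unfold_syntax const_map_def; fail))+
  \<comment> \<open>\<open>Fst\<close> of the embedding computes to the constant map, its value to
    \<open>Star u\<close>, and the map being extended to \<open>InL\<close>.\<close>
  apply (assumption | rule q_split_beta[where E="Emb (Var 4) (Unit u)"] eq_refl q_pi q_id
    q_app_beta_left[where b="InL (Var 0)" and B="Plus (Var 5) (Unit u)"]
    q_app_beta_left q_app_head[where f="Split C d p" for C d p] q_app
    r_split_at[where E="Emb (Var 5) (Unit u)" and C="Pi (Var 6) (Unit u)", unfolded unary]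
      const_map_embedding typing
    | (simp (no_asm) add: unfold_syntax const_map_def; fail))+
  done

section \<open>From excluded middle to injectivity\<close>

text \<open>The value at \<open>y\<close> of the extension of \<open>f\<close>, where \<open>s\<close> decides the fiber over \<open>y\<close>.\<close>

definition extend_at :: "'l tm \<Rightarrow> 'l tm \<Rightarrow> 'l tm \<Rightarrow> 'l tm \<Rightarrow> 'l tm \<Rightarrow> 'l tm"
  where "extend_at X D d f s = Cases (wk 1 D) (App (wk 1 f) (Fst (wk 1 X) (Var 0))) (wk 1 d) s"

definition decidable_fiber :: "'l \<Rightarrow> 'l tm \<Rightarrow> 'l tm \<Rightarrow> 'l tm \<Rightarrow> 'l tm \<Rightarrow> 'l tm"
  where "decidable_fiber u X Y j y = Plus (fiber X Y j y) (Arr (fiber X Y j y) (Empty u))"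

text \<open>
  The fiber over \<open>j x\<close> contains \<open>(x, refl)\<close>.  If \<open>s\<close> is an \<open>inl w\<close>, then \<open>w = (x, refl)\<close> since \<open>j\<close>
  is an embedding; \<open>s\<close> cannot be an \<open>inr\<close>.
\<close>

definition extend_at_eq :: "'l \<Rightarrow> 'l tm"
  where "extend_at_eq u = Lam (Univ u) (Lam (Var 0)
    (Lam (Univ u) (Lam (Univ u) (Lam (Arr (Var 1) (Var 0))
    (Lam (is_embedding (Var 2) (Var 1) (Var 0)) (Lam (Arr (Var 3) (Var 5)) (Lam (Var 4)
    (Lam (decidable_fiber u (Var 5) (Var 4) (Var 3) (App (Var 3) (Var 0)))
    (Cases (IdT (Var 9) (extend_at (Var 7) (Var 9) (Var 8) (Var 3) (Var 0)) (App (Var 3) (Var 2)))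
      (ascribe (IdT (Var 9) (extend_at (Var 7) (Var 9) (Var 8) (Var 3) (InL (Var 0)))
        (App (Var 3) (Var 2)))
        (J (IdT (Var 12) (App (Var 6) (Fst (Var 10) (Var 2))) (App (Var 6) (Fst (Var 10) (Var 1))))
          (Rfl (App (Var 4) (Fst (Var 8) (Var 0))))
          (Var 0) (Pr (Var 2) (Rfl (App (Var 5) (Var 2))))
          (apps (Var 4) [App (Var 5) (Var 2), Var 0, Pr (Var 2) (Rfl (App (Var 5) (Var 2)))])))
      (Absurd (IdT (Var 10) (extend_at (Var 8) (Var 10) (Var 9) (Var 4) (InR (Var 1)))
        (App (Var 4) (Var 3)))
        (App (Var 0) (Pr (Var 2) (Rfl (App (Var 5) (Var 2))))))
      (Var 0))))))))))"

lemma extend_at_eq_closed [simp]: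
  "rename \<xi> (extend_at_eq u) = extend_at_eq u"
  "subst \<sigma> (extend_at_eq u) = extend_at_eq u"
  by (simp_all add: extend_at_eq_def extend_at_def decidable_fiber_def unfold_syntax)

lemma extend_at_eq:
  assumes "\<Gamma> \<turnstile> ctx"
    and "T = Pi (Univ u) (Pi (Var 0) (Pi (Univ u) (Pi (Univ u) (Pi (Arr (Var 1) (Var 0))
    (Pi (is_embedding (Var 2) (Var 1) (Var 0)) (Pi (Arr (Var 3) (Var 5)) (Pi (Var 4)
    (Pi (decidable_fiber u (Var 5) (Var 4) (Var 3) (App (Var 3) (Var 0)))
    (IdT (Var 8) (extend_at (Var 6) (Var 8) (Var 7) (Var 2) (Var 0)) (App (Var 2) (Var 1)))))))))))"
  shows "\<Gamma> \<turnstile> extend_at_eq u \<Colon> T"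
  using assms unfolding extend_at_eq_def
  apply (simp add: unfold_syntax extend_at_def decidable_fiber_def)
  \<comment> \<open>In the \<open>InL\<close> branch, \<open>extend_at\<close> at
    \<open>InL w\<close> computes to f (\<open>Fst\<close> w), and \<open>Fst\<close> of (x, refl)
    to x.\<close>
  apply (assumption | rule r_inr_at[where E="decidable_fiber u (Var 8) (Var 7) (Var 6)
    (App (Var 6) (Var 3))"] typing q_id
     q_cases_inl[where E="decidable_fiber u (Var 7) (Var 6) (Var 5) (App (Var 5) (Var 2))",
       THEN eq_sym]
     q_split_beta[where E="fiber (Var 7) (Var 6) (Var 5) (App (Var 5) (Var 2))"] eq_refl q_app
      | (simp (no_asm) add: unfold_syntax decidable_fiber_def; fail))+
  done

text \<open>The embedding is passed as a map and a proof, so it need not be projected; the proof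
  makes each fiber a proposition that excluded middle can decide.\<close>

definition extension :: "'l \<Rightarrow> 'l tm"
  where "extension u = Lam (excluded_middle u)
    (Lam (Univ u) (Lam (Var 0) (Lam (Univ u) (Lam (Univ u) (Lam (Arr (Var 1) (Var 0))
    (Lam (is_embedding (Var 2) (Var 1) (Var 0)) (Lam (Arr (Var 3) (Var 5))
    (let g = Lam (Var 3) (extend_at (Var 5) (Var 7) (Var 6) (Var 1)
      (apps (Var 8) [fiber (Var 5) (Var 4) (Var 3) (Var 0), App (Var 2) (Var 0)])) in
    Pr g (Lam (Var 4)
     (ascribe (IdT (Var 7) (App (comp (Var 5) (wk 1 g) (Var 3)) (Var 0)) (App (Var 1) (Var 0)))
     (apps (extend_at_eq u) [Var 7, Var 6, Var 5, Var 4, Var 3, Var 2, Var 1, Var 0,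
       apps (Var 8) [fiber (Var 5) (Var 4) (Var 3) (App (Var 3) (Var 0)), App (Var 2)
         (App (Var 3) (Var 0))]])))))))))))"

lemma extension_closed [simp]:
  "rename \<xi> (extension u) = extension u"
  "subst \<sigma> (extension u) = extension u"
  by (simp_all add: extension_def extend_at_def unfold_syntax)

text \<open>The part of \<open>alg_injective\<close> after the embedding, with its map abstracted to
  serve as a motive.\<close>

definition extends :: "'l tm \<Rightarrow> 'l tm \<Rightarrow> 'l tm \<Rightarrow> 'l tm \<Rightarrow> 'l tm"
  where "extends X Y D j = Pi (Arr X D) (Sig (Arr (wk 1 Y) (wk 1 D))
    (pointwise_eq (wk 2 X) (wk 2 D) (comp (wk 2 X) (Var 0) (wk 2 j)) (Var 1)))"

lemma extension:
  assumes "\<Gamma> \<turnstile> ctx"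
    and "T = Pi (excluded_middle u) (Pi (Univ u)
      (Pi (Var 0) (Pi (Univ u) (Pi (Univ u) (Pi (Arr (Var 1) (Var 0))
    (Pi (is_embedding (Var 2) (Var 1) (Var 0)) (extends (Var 3) (Var 2) (Var 5) (Var 1))))))))"
  shows "\<Gamma> \<turnstile> extension u \<Colon> T"
  using assms unfolding extension_def
  apply (simp add: unfold_syntax extend_at_def extends_def)
  apply (assumption | rule typing extend_at_eq eq_refl q_id q_app_beta_right
      | (simp (no_asm) add: unfold_syntax decidable_fiber_def extend_at_def; fail))+
  done

definition injective_of_em :: "'l \<Rightarrow> 'l tm"
  where "injective_of_em u = Lam (excluded_middle u)
    (Lam (Univ u) (Lam (Var 0) (Lam (Univ u) (Lam (Univ u) (Lam (Emb (Var 1) (Var 0))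
    (Split (extends (Var 3) (Var 2) (Var 5) (Fst (Arr (Var 3) (Var 2)) (Var 0)))
      (ascribe (extends (Var 4) (Var 3) (Var 6) (Fst (Arr (Var 4) (Var 3)) (Pr (Var 1) (Var 0))))
        (apps (extension u) [Var 7, Var 6, Var 5, Var 4, Var 3, Var 1, Var 0]))
      (Var 0)))))))"

lemma injective_of_em:
  assumes "\<Gamma> \<turnstile> ctx"
    and "T = Arr (excluded_middle u) (all_pointed_alg_injective u)"
  shows "\<Gamma> \<turnstile> injective_of_em u \<Colon> T"
  using assms unfolding injective_of_em_def
  apply (simp add: unfold_syntax extends_def)
  \<comment> \<open>The ascription replaces j by \<open>Fst\<close> of the pair, as the motive of
    the outer \<open>Split\<close> demands.\<close>
  apply (assumption | rule r_split_at[where E="Emb (Var 8) (Var 7)" and C="Pi (Var 9) (Var 9)",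
    unfolded unary]
    q_split_beta[where E="Emb (Var 7) (Var 6)", THEN eq_sym]
    typing extension eq_refl q_pi q_sig q_id q_app_beta_left q_app_beta_right q_app
      | (simp (no_asm) add: unfold_syntax extends_def; fail))+
  done

theorem theorem60:
  fixes u :: "'l::universe_level"
  shows "inhabited (Arr (all_pointed_alg_injective u) (excluded_middle u)) \<and>
         inhabited (Arr (excluded_middle u) (all_pointed_alg_injective u))"
  unfolding inhabited_def using em_of_injective[OF ctx_nil refl] injective_of_em[OF ctx_nil refl]
    by blast

end
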